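(* Let $A_1,\dots,A_M\in\mathbb{R}^{n\times n}$, $\mathcal{M}=\{1,\dots,M\}$ and $A(w)=\sum_{i\in\mathcal{M}}w_iA_i$ for $w\in\mathcal{W}$. Let $\tau>0$ and let $V$ be a positively homogeneous weak convex Lyapunov function for the Euler auxiliary difference inclusion $x(k+1)=(I+\tau A(w(k)))x(k)$. Define $$\Delta_\tau V(x,w)=\frac{V(x+\tau A(w)x)-V(x)}{\tau},$$ which is non-positive. Then every solution $x(t)$ of the differential inclusion $\dot x(t)=A(w(t))x(t)$ converges to the set $$\mathcal{D}=\Big\{x\in\mathbb{R}^n\ \Big|\ \min_{w\in\mathcal{W}}\{-\Delta_\tau V(x,w)\}=0\Big\}.$$
   Context: $\mathcal{W}=\{w\in\mathbb{R}^M:\ \sum_{i\in\mathcal{M}}w_i=1,\ w_i\ge0\ \forall i\in\mathcal{M}\}$; solutions of the differential inclusion are those generated by measurable functions $w(t)\in\mathcal{W}$, $t\ge0$, and arbitrary $x(0)\in\mathbb{R}^n$. A weak convex Lyapunov function for the Euler auxiliary difference inclusion is a convex positive definite function $V:\mathbb{R}^n\to\mathbb{R}_{\ge0}$ with $V((I+\tau A(w))x)\le V(x)$ for all $x\in\mathbb{R}^n$, $w\in\mathcal{W}$. Positively homogeneous means $V(\lambda x)=\lambda^pV(x)$ for all $\lambda\ge0$, $x\in\mathbb{R}^n$, for some order $p>0$. Convergence to a set means that the distance from $x(t)$ to the set tends to $0$ as $t\to\infty$. *)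

theory Defs
  imports "HOL-Analysis.Analysis"
begin

definition weights :: "(real ^ 'm) set" where
  "weights = {w. (\<Sum>i\<in>UNIV. w $ i) = 1 \<and> (\<forall>i. 0 \<le> w $ i)}"

definition comb :: "('m::finite \<Rightarrow> real ^ 'n ^ 'n) \<Rightarrow> real ^ 'm \<Rightarrow> real ^ 'n ^ 'n" where
  "comb A w = (\<Sum>i\<in>UNIV. (w $ i) *\<^sub>R A i)"

definition positive_definite_fun :: "('a::zero \<Rightarrow> real) \<Rightarrow> bool" where
  "positive_definite_fun V \<longleftrightarrow> V 0 = 0 \<and> (\<forall>x. x \<noteq> 0 \<longrightarrow> 0 < V x)"

definition positively_homogeneous :: "('a::real_vector \<Rightarrow> real) \<Rightarrow> bool" where
  "positively_homogeneous V \<longleftrightarrow>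
     (\<exists>p::real. 0 < p \<and> (\<forall>c x. 0 \<le> c \<longrightarrow> V (c *\<^sub>R x) = c powr p * V x))"

definition weak_convex_lyapunov ::
    "real \<Rightarrow> ('m::finite \<Rightarrow> real ^ 'n ^ 'n) \<Rightarrow> (real ^ 'n \<Rightarrow> real) \<Rightarrow> bool" where
  "weak_convex_lyapunov \<tau> A V \<longleftrightarrow>
     convex_on UNIV V \<and> positive_definite_fun V \<and>
     (\<forall>x. \<forall>w\<in>weights. V ((mat 1 + \<tau> *\<^sub>R comb A w) *v x) \<le> V x)"

definition euler_diff ::
    "real \<Rightarrow> ('m::finite \<Rightarrow> real ^ 'n ^ 'n) \<Rightarrow> (real ^ 'n \<Rightarrow> real) \<Rightarrow> real ^ 'n \<Rightarrow> real ^ 'm \<Rightarrow> real" where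
  "euler_diff \<tau> A V x w = (V (x + \<tau> *\<^sub>R (comb A w *v x)) - V x) / \<tau>"

text \<open>
  The condition on \<open>x\<close> says that the minimum over all weights is attained and has value \<open>0\<close>.
  (The set always contains the origin.)
\<close>
definition min_zero_set ::
    "real \<Rightarrow> ('m::finite \<Rightarrow> real ^ 'n ^ 'n) \<Rightarrow> (real ^ 'n \<Rightarrow> real) \<Rightarrow> (real ^ 'n) set" where
  "min_zero_set \<tau> A V =
     {x. \<exists>w. is_arg_min (\<lambda>w. - euler_diff \<tau> A V x w) (\<lambda>w. w \<in> weights) w \<and>
             - euler_diff \<tau> A V x w = 0}"

text \<open>
  Absolute continuity of a function on an interval, in the usual \<open>\<epsilon>\<close>-\<open>\<delta>\<close> sense.
  A division of \<open>\<Union>d\<close> is a finite family of nonempty compact intervals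
  with pairwise disjoint interiors, and \<open>Inf k\<close>, \<open>Sup k\<close> are the end points of \<open>k\<close>.
\<close>
definition abs_continuous_fun_on :: "real set \<Rightarrow> (real \<Rightarrow> 'a::real_normed_vector) \<Rightarrow> bool" where
  "abs_continuous_fun_on S f \<longleftrightarrow>
     (\<forall>\<epsilon>>0. \<exists>\<delta>>0. \<forall>d. d division_of \<Union>d \<and> \<Union>d \<subseteq> S \<and> (\<Sum>k\<in>d. Sup k - Inf k) < \<delta> \<longrightarrow>
        (\<Sum>k\<in>d. norm (f (Sup k) - f (Inf k))) < \<epsilon>)"

text \<open>
  Caratheodory solutions on \<open>[0, \<infinity>)\<close>: locally absolutely continuous, with the differential
  equation holding almost everywhere for some measurable weight function. Values at
  negative times are irrelevant.
\<close>
definition inclusion_solution ::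
    "('m::finite \<Rightarrow> real ^ 'n ^ 'n) \<Rightarrow> (real \<Rightarrow> real ^ 'n) \<Rightarrow> bool" where
  "inclusion_solution A x \<longleftrightarrow>
     (\<exists>w. w \<in> borel_measurable (lebesgue_on {0..}) \<and> (\<forall>t\<ge>0. w t \<in> weights) \<and>
          (\<forall>T\<ge>0. abs_continuous_fun_on {0..T} x) \<and>
          (AE t in lebesgue_on {0..}.
             (x has_vector_derivative comb A (w t) *v x t) (at t within {0..})))"

end

theory Submission
  imports Defs
begin

text \<open>
  This is a LaSalle argument whose decay rate is read off from the Euler step.
  On the segment from \<open>x\<close> to the Euler point \<open>x + \<tau> A(w) x\<close> the convex function \<open>V\<close> lies below its
  chord, and the slope of that chord is \<open>\<Delta>\<^sub>\<tau> V(x, w)\<close>. Hence \<open>\<Delta>\<^sub>\<tau> V(x, w)\<close> bounds the right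
  derivative of \<open>V\<close> in the direction \<open>A(w) x\<close>. It bounds the left derivative as well, because the left
  derivative of a convex function never exceeds the right one
  (\<open>convex_on_ray_bounds\<close>).

  A solution is only absolutely continuous and solves the equation only almost everywhere, so these
  pointwise bounds must be summed into a bound on the increments of \<open>V\<close> along the solution.
  Since convex functions are locally Lipschitz, \<open>V\<close> along the solution is absolutely
  continuous, and \<open>abs_continuous_growth_bound\<close> does the summation with a gauge: away from the
  exceptional null set a short interval inherits the pointwise bound, and the intervals tagged in the
  null set are so short in total that absolute continuity makes their contribution negligible.
  The outcome, \<open>convex_along_abs_continuous\<close>, is used twice: for \<open>V\<close> itself, and for the distance to a
  point of the trajectory, where it yields a Lipschitz bound in time.

  It follows that \<open>V\<close> does not increase along a solution; as its sublevel sets are bounded, the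
  solution is bounded, and then it is Lipschitz in time. If its distance to \<open>\<D>\<close> did not tend to \<open>0\<close>,
  the solution would be at distance at least some \<open>e > 0\<close> at arbitrarily late times, and would stay at
  distance at least \<open>e/2\<close> for a fixed duration \<open>h\<close> after each of them. On the compact set of bounded
  points at distance at least \<open>e/2\<close>, and over the compact set of weights, \<open>\<Delta>\<^sub>\<tau> V\<close> is at most some
  \<open>-\<gamma> < 0\<close> (\<open>euler_diff_uniformly_negative\<close>). Each such visit therefore costs at least \<open>\<gamma> h\<close>, which
  the nonnegative function \<open>V\<close> can afford only finitely often.
\<close>

section \<open>Absolutely continuous functions\<close>

lemma abs_continuous_fun_on_subset:
  assumes "abs_continuous_fun_on T f" "S \<subseteq> T"
  shows "abs_continuous_fun_on S f"
  using assms unfolding abs_continuous_fun_on_def by (meson subset_trans)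

lemma abs_continuous_imp_continuous_on:
  fixes f :: "real \<Rightarrow> 'a::real_normed_vector"
  assumes "abs_continuous_fun_on {a..b} f"
  shows "continuous_on {a..b} f"
  unfolding continuous_on_iff
proof (intro ballI allI impI)
  fix s e :: real
  assume s: "s \<in> {a..b}" and "0 < e"
  with assms obtain \<delta> where "\<delta> > 0"
    and \<delta>: "\<And>d. \<lbrakk>d division_of \<Union>d; \<Union>d \<subseteq> {a..b}; (\<Sum>k\<in>d. Sup k - Inf k) < \<delta>\<rbrakk>
           \<Longrightarrow> (\<Sum>k\<in>d. norm (f (Sup k) - f (Inf k))) < e"
    unfolding abs_continuous_fun_on_def by meson
  have *: "norm (f v - f u) < e" if "u \<le> v" "a \<le> u" "v \<le> b" "v - u < \<delta>" for u v
  proof -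
    have "{cbox u v} division_of cbox u v"
      using that by (intro division_of_self) auto
    then show ?thesis
      using \<delta>[of "{{u..v}}"] that by simp
  qed
  have "dist (f t) (f s) < e" if "t \<in> {a..b}" "dist t s < \<delta>" for t
    using *[of t s] *[of s t] that s by (cases "t \<le> s") (auto simp: dist_norm norm_minus_commute)
  with \<open>\<delta> > 0\<close> show "\<exists>d>0. \<forall>t\<in>{a..b}. dist t s < d \<longrightarrow> dist (f t) (f s) < e"
    by blast
qed

lemma abs_continuous_lipschitz_compose:
  fixes x :: "real \<Rightarrow> 'a::real_normed_vector" and f :: "'a \<Rightarrow> 'b::real_normed_vector"
  assumes ac: "abs_continuous_fun_on {a..b} x"
    and lip: "\<And>y z. y \<in> x ` {a..b} \<Longrightarrow> z \<in> x ` {a..b} \<Longrightarrow> norm (f y - f z) \<le> L * norm (y - z)"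
    and "0 \<le> L"
  shows "abs_continuous_fun_on {a..b} (f \<circ> x)"
  unfolding abs_continuous_fun_on_def
proof (intro allI impI)
  fix e :: real assume "0 < e"
  then have "0 < e / (L + 1)" using \<open>0 \<le> L\<close> by simp
  with ac obtain \<delta> where "\<delta> > 0"
    and \<delta>: "\<And>d. \<lbrakk>d division_of \<Union>d; \<Union>d \<subseteq> {a..b}; (\<Sum>k\<in>d. Sup k - Inf k) < \<delta>\<rbrakk>
           \<Longrightarrow> (\<Sum>k\<in>d. norm (x (Sup k) - x (Inf k))) < e / (L + 1)"
    unfolding abs_continuous_fun_on_def by meson
  have "(\<Sum>k\<in>d. norm ((f \<circ> x) (Sup k) - (f \<circ> x) (Inf k))) < e"
    if d: "d division_of \<Union>d" "\<Union>d \<subseteq> {a..b}" "(\<Sum>k\<in>d. Sup k - Inf k) < \<delta>" for d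
  proof -
    let ?S = "\<Sum>k\<in>d. norm (x (Sup k) - x (Inf k))"
    have "(\<Sum>k\<in>d. norm ((f \<circ> x) (Sup k) - (f \<circ> x) (Inf k))) \<le> (\<Sum>k\<in>d. L * norm (x (Sup k) - x (Inf k)))"
    proof (rule sum_mono)
      fix k assume k: "k \<in> d"
      obtain u v where uv: "k = {u..v}" "u \<le> v"
        using division_ofD(3,4)[OF d(1) k] by (metis atLeastatMost_empty_iff2 box_real(2))
      then have "k \<subseteq> {a..b}" using d(2) k by blast
      then have "Sup k \<in> {a..b}" "Inf k \<in> {a..b}" using uv by auto
      then show "norm ((f \<circ> x) (Sup k) - (f \<circ> x) (Inf k)) \<le> L * norm (x (Sup k) - x (Inf k))"
        using lip by simp
    qed
    also have "\<dots> = L * ?S" by (simp add: sum_distrib_left)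
    also have "\<dots> \<le> (L + 1) * ?S" by (intro mult_right_mono sum_nonneg) auto
    also have "\<dots> < e"
      using \<delta>[OF d] \<open>0 \<le> L\<close> by (simp add: field_simps)
    finally show ?thesis .
  qed
  with \<open>\<delta> > 0\<close> show "\<exists>\<delta>>0. \<forall>d. d division_of \<Union>d \<and> \<Union>d \<subseteq> {a..b} \<and> (\<Sum>k\<in>d. Sup k - Inf k) < \<delta> \<longrightarrow>
        (\<Sum>k\<in>d. norm ((f \<circ> x) (Sup k) - (f \<circ> x) (Inf k))) < e"
    by blast
qed

text \<open>
  The mean value inequality for absolutely continuous functions. The premise bounds the increments
  over intervals that contain \<open>t\<close>, which is what a derivative bound at \<open>t\<close> gives even when the left
  and right derivatives differ. The proof takes a fine tagged division: the intervals with tags outside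
  \<open>N\<close> obey the premise, and those with tags in \<open>N\<close> lie in an open set of small measure.
\<close>

lemma abs_continuous_growth_bound:
  fixes f :: "real \<Rightarrow> real"
  assumes ac: "abs_continuous_fun_on {a..b} f" and "a \<le> b" and "negligible N"
    and straddle: "\<And>t e. \<lbrakk>t \<in> {a..b} - N; 0 < e\<rbrakk> \<Longrightarrow>
      \<exists>\<delta>>0. \<forall>u v. a \<le> u \<and> u \<le> t \<and> t \<le> v \<and> v \<le> b \<and> t - u < \<delta> \<and> v - t < \<delta>
         \<longrightarrow> f v - f u \<le> (c + e) * (v - u)"
  shows "f b - f a \<le> c * (b - a)"
proof -
  define C where "C = b - a + \<bar>c\<bar> + 2"
  \<comment> \<open>The two summands with \<open>e\<close> beyond \<open>e * (b - a)\<close> come from the tags in \<open>N\<close>: the variation of \<open>f\<close>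
     over their intervals, and the total length of these times \<open>\<bar>c\<bar> + 1\<close>.\<close>
  have main: "f b - f a - c * (b - a) \<le> e * C" if "0 < e" "e \<le> 1" for e
  proof -
    obtain \<delta> where "\<delta> > 0"
      and \<delta>: "\<And>d. \<lbrakk>d division_of \<Union>d; \<Union>d \<subseteq> {a..b}; (\<Sum>k\<in>d. Sup k - Inf k) < \<delta>\<rbrakk>
           \<Longrightarrow> (\<Sum>k\<in>d. norm (f (Sup k) - f (Inf k))) < e"
      using ac \<open>0 < e\<close> unfolding abs_continuous_fun_on_def by meson
    have N: "N \<in> null_sets lebesgue" using \<open>negligible N\<close> negligible_iff_null_sets by blast
    obtain U where U: "open U" "N \<subseteq> U" "U - N \<in> lmeasurable"
        "emeasure lebesgue (U - N) < ennreal (min \<delta> e)"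
      using sets_lebesgue_outer_open[of N "min \<delta> e"] N \<open>\<delta> > 0\<close> \<open>0 < e\<close> by auto
    have Um: "U \<in> lmeasurable"
      using U(2,3) N by (metis Diff_partition fmeasurable.Un negligible_imp_measurable assms(3))
    have "measure lebesgue U = measure lebesgue (U - N)"
      using N Um by (simp add: measure_Diff_null_set)
    also have "\<dots> < min \<delta> e"
      using U(3,4) \<open>\<delta> > 0\<close> \<open>0 < e\<close> by (simp add: emeasure_eq_measure2 ennreal_less_iff)
    finally have Usmall: "measure lebesgue U < \<delta>" "measure lebesgue U < e" by auto
    have "\<forall>t\<in>{a..b} - N. \<exists>r>0. \<forall>u v. a \<le> u \<and> u \<le> t \<and> t \<le> v \<and> v \<le> b \<and> t - u < r \<and> v - t < r
         \<longrightarrow> f v - f u \<le> (c + e) * (v - u)"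
      using straddle \<open>0 < e\<close> by blast
    then obtain r where r: "\<And>t. t \<in> {a..b} - N \<Longrightarrow> r t > 0"
      "\<And>t u v. \<lbrakk>t \<in> {a..b} - N; a \<le> u; u \<le> t; t \<le> v; v \<le> b; t - u < r t; v - t < r t\<rbrakk>
         \<Longrightarrow> f v - f u \<le> (c + e) * (v - u)"
      by metis
    define \<gamma> where "\<gamma> t = (if t \<in> N then U else ball t (if t \<in> {a..b} then r t else 1))" for t
    have "gauge \<gamma>"
      unfolding gauge_def \<gamma>_def using U(1,2) r(1) by auto
    then obtain p where p: "p tagged_division_of {a..b}" "\<gamma> fine p"
      using fine_division_exists_real by blast
    have K: "\<exists>u v. K = {u..v} \<and> a \<le> u \<and> u \<le> t \<and> t \<le> v \<and> v \<le> b" if tK: "(t, K) \<in> p" for t K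
    proof -
      obtain u v where uv: "K = {u..v}" using tagged_division_ofD(4)[OF p(1) tK] by auto
      moreover have "t \<in> K" "K \<subseteq> {a..b}"
        using tagged_division_ofD(2,3)[OF p(1) tK] by auto
      ultimately have "u \<le> t" "t \<le> v" "u \<in> {a..b}" "v \<in> {a..b}" by auto
      with uv show ?thesis by auto
    qed
    have "finite p" using p(1) by blast
    define p1 where "p1 = {q \<in> p. fst q \<in> N}"
    define d where "d = snd ` p1"
    have part: "p1 tagged_partial_division_of {a..b}"
      using p(1) unfolding tagged_division_of_def p1_def by (blast intro: tagged_partial_division_subset)
    have div: "d division_of \<Union>d"
      unfolding d_def by (rule partial_division_of_tagged_division[OF part])
    have "k \<subseteq> {a..b} \<and> k \<subseteq> U" if "k \<in> d" for k
    proof -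
      from that obtain t where t: "(t, k) \<in> p" "t \<in> N" unfolding d_def p1_def by auto
      then have "k \<subseteq> \<gamma> t" using p(2) unfolding fine_def by blast
      with t show ?thesis using tagged_division_ofD(3)[OF p(1)] by (simp add: \<gamma>_def)
    qed
    then have dsub: "\<Union>d \<subseteq> {a..b}" and dU: "\<Union>d \<subseteq> U" by blast+
    have dk: "\<exists>u v. k = {u..v} \<and> u \<le> v" if "k \<in> d" for k
      using that K unfolding d_def p1_def by fastforce
    \<comment> \<open>Absolute continuity speaks of divisions without tags. Only degenerate intervals can carry two
       tags, and they contribute nothing to a sum of increments.\<close>
    have transfer: "(\<Sum>(t,k)\<in>p1. h (Inf k) (Sup k)) = (\<Sum>k\<in>d. h (Inf k) (Sup k))"
      if h0: "\<And>s. h s s = 0" for h :: "real \<Rightarrow> real \<Rightarrow> real"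
    proof -
      \<comment> \<open>\<open>h (Inf {}) (Sup {})\<close> is an unspecified value, so the empty box needs its own case.\<close>
      let ?g = "\<lambda>k. if k = {} then 0 else h (Inf k) (Sup k)"
      have "(\<Sum>(t,k)\<in>p1. h (Inf k) (Sup k)) = (\<Sum>(t,k)\<in>p1. ?g k)"
        using K by (intro sum.cong) (fastforce simp: p1_def)+
      also have "\<dots> = (\<Sum>k\<in>d. ?g k)"
        unfolding d_def
      proof (rule sum.over_tagged_division_lemma[OF tagged_partial_division_of_Union_self[OF part]])
        fix u v :: real assume "box u v = {}"
        then have "v \<le> u" by simp
        then show "?g (cbox u v) = 0" using h0 by (cases "u = v") auto
      qed
      also have "\<dots> = (\<Sum>k\<in>d. h (Inf k) (Sup k))"
        using dk by (intro sum.cong) fastforce+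
      finally show ?thesis .
    qed
    have "(\<Sum>k\<in>d. Sup k - Inf k) = (\<Sum>k\<in>d. measure lebesgue k)"
    proof (rule sum.cong)
      fix k assume "k \<in> d"
      with dk obtain u v where "k = {u..v}" "u \<le> v" by blast
      then show "Sup k - Inf k = measure lebesgue k" by simp
    qed simp
    also have "\<dots> = measure lebesgue (\<Union>d)" by (rule content_division[OF div])
    also have "\<dots> \<le> measure lebesgue U"
      using dU Um lmeasurable_division[OF div] by (intro measure_mono_fmeasurable) auto
    finally have len: "(\<Sum>k\<in>d. Sup k - Inf k) \<le> measure lebesgue U" .
    have var: "(\<Sum>k\<in>d. norm (f (Sup k) - f (Inf k))) < e"
      using \<delta>[OF div dsub] len Usmall by simp
    let ?h = "\<lambda>k. f (Sup k) - f (Inf k) - (c + e) * (Sup k - Inf k)"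
    have "f b - f a - (c + e) * (b - a) = (\<Sum>(t,k)\<in>p. ?h k)"
      using additive_tagged_division_1[OF \<open>a \<le> b\<close> p(1), of "\<lambda>s. f s - (c + e) * s"]
      by (simp add: algebra_simps)
    also have "\<dots> = (\<Sum>(t,k)\<in>p - p1. ?h k) + (\<Sum>(t,k)\<in>p1. ?h k)"
      using \<open>finite p\<close> by (intro sum.subset_diff) (auto simp: p1_def)
    also have "(\<Sum>(t,k)\<in>p - p1. ?h k) \<le> 0"
    proof (rule sum_nonpos, clarify)
      fix t k assume tk: "(t, k) \<in> p" "(t, k) \<notin> p1"
      obtain u v where uv: "k = {u..v}" "a \<le> u" "u \<le> t" "t \<le> v" "v \<le> b"
        using K[OF tk(1)] by blast
      have t: "t \<in> {a..b} - N" using tk uv by (auto simp: p1_def)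
      have "k \<subseteq> ball t (r t)"
        using p(2) tk(1) t unfolding fine_def \<gamma>_def by fastforce
      moreover have "u \<in> k" "v \<in> k" using uv by auto
      ultimately have "u \<in> ball t (r t)" "v \<in> ball t (r t)" by blast+
      then have "t - u < r t" "v - t < r t" by (auto simp: dist_real_def)
      then show "?h k \<le> 0" using r(2)[OF t] uv by simp
    qed
    also have "(\<Sum>(t,k)\<in>p1. ?h k) = (\<Sum>k\<in>d. ?h k)"
      by (rule transfer[of "\<lambda>s s'. f s' - f s - (c + e) * (s' - s)"]) simp
    also have "\<dots> \<le> (\<Sum>k\<in>d. norm (f (Sup k) - f (Inf k)) + (\<bar>c\<bar> + 1) * (Sup k - Inf k))"
    proof (rule sum_mono)
      fix k assume "k \<in> d"
      with dk obtain u v where uv: "k = {u..v}" "u \<le> v" by blast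
      have "- (c + e) * (v - u) \<le> (\<bar>c\<bar> + 1) * (v - u)"
        using uv \<open>0 < e\<close> by (intro mult_right_mono) auto
      then have "- ((c + e) * (v - u)) \<le> (\<bar>c\<bar> + 1) * (v - u)"
        by (simp only: mult_minus_left)
      moreover have "f v - f u \<le> norm (f v - f u)" by simp
      ultimately show "?h k \<le> norm (f (Sup k) - f (Inf k)) + (\<bar>c\<bar> + 1) * (Sup k - Inf k)"
        using uv by (simp del: mult_minus_left real_norm_def)
    qed
    also have "\<dots> = (\<Sum>k\<in>d. norm (f (Sup k) - f (Inf k))) + (\<bar>c\<bar> + 1) * (\<Sum>k\<in>d. Sup k - Inf k)"
      by (simp add: sum.distrib sum_distrib_left)
    also have "\<dots> \<le> e + (\<bar>c\<bar> + 1) * e"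
      using var len Usmall by (intro add_mono mult_left_mono) auto
    finally show ?thesis by (simp add: C_def algebra_simps)
  qed
  have "C > 0" using \<open>a \<le> b\<close> by (simp add: C_def)
  show ?thesis
  proof (rule ccontr)
    assume "\<not> ?thesis"
    then have pos: "0 < f b - f a - c * (b - a)" (is "0 < ?X") by simp
    define e where "e = min 1 (?X / (2 * C))"
    have "0 < e" "e \<le> 1" using pos \<open>C > 0\<close> by (auto simp: e_def)
    from main[OF this] have "?X \<le> e * C" .
    also have "\<dots> \<le> ?X / (2 * C) * C" using \<open>C > 0\<close> by (intro mult_right_mono) (auto simp: e_def)
    also have "\<dots> = ?X / 2" using \<open>C > 0\<close> by simp
    finally show False using pos by simp
  qed
qed

section \<open>Convex functions along curves\<close>

text \<open>
  A bound for \<open>V\<close> on the ball of radius \<open>R + 1\<close> controls its slopes on the ball of radius \<open>R\<close>: the segment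
  from \<open>x\<close> to \<open>y\<close> extends by length \<open>1\<close> to a point \<open>z\<close> of the larger ball, and slopes of a convex
  function increase along a line.
\<close>

lemma convex_on_lipschitz_cball:
  fixes V :: "'a::euclidean_space \<Rightarrow> real"
  assumes V: "convex_on UNIV V"
  obtains L where "0 \<le> L" "\<And>y z. y \<in> cball 0 R \<Longrightarrow> z \<in> cball 0 R \<Longrightarrow> \<bar>V y - V z\<bar> \<le> L * norm (y - z)"
proof -
  have "continuous_on (cball 0 (R + 1)) V"
    using convex_on_continuous[OF open_UNIV V] continuous_on_subset by blast
  then have "bounded (V ` cball 0 (R + 1))"
    by (intro compact_imp_bounded compact_continuous_image) auto
  then obtain B where "B > 0" and B: "\<And>z. z \<in> cball 0 (R + 1) \<Longrightarrow> \<bar>V z\<bar> \<le> B"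
    unfolding bounded_pos by auto
  have one: "V y - V x \<le> 2 * B * norm (y - x)" if x: "x \<in> cball 0 R" and y: "y \<in> cball 0 R" for x y
  proof (cases "x = y")
    case False
    define r where "r = norm (y - x)"
    define z where "z = y + (1 / r) *\<^sub>R (y - x)"
    define s where "s = r / (1 + r)"
    have "r > 0" using False by (simp add: r_def)
    then have s: "0 \<le> s" "s \<le> 1" "s \<le> r" by (auto simp: s_def field_simps)
    have "norm ((1 / r) *\<^sub>R (y - x)) = 1" using \<open>r > 0\<close> by (simp add: r_def)
    then have "norm z \<le> norm y + 1"
      using norm_triangle_ineq[of y "(1 / r) *\<^sub>R (y - x)"] unfolding z_def by linarith
    then have z: "z \<in> cball 0 (R + 1)" using y by simp
    have "(1 + r) *\<^sub>R ((1 - s) *\<^sub>R x + s *\<^sub>R z) = (1 + r) *\<^sub>R y"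
    proof -
      have "(1 + r) * (1 - s) = 1" "(1 + r) * s = r" using \<open>r > 0\<close> by (auto simp: s_def field_simps)
      then have "(1 + r) *\<^sub>R ((1 - s) *\<^sub>R x + s *\<^sub>R z) = x + r *\<^sub>R z"
        by (simp add: scaleR_add_right)
      then show ?thesis using \<open>r > 0\<close> by (simp add: z_def algebra_simps)
    qed
    then have "y = (1 - s) *\<^sub>R x + s *\<^sub>R z" using \<open>r > 0\<close> by simp
    then have "V y \<le> (1 - s) * V x + s * V z"
      using convex_onD[OF V s(1,2)] by simp
    then have "V y - V x \<le> s * (V z - V x)" by (simp add: algebra_simps)
    also have "\<dots> \<le> s * (2 * B)"
      using B[OF z] B[of x] x s by (intro mult_left_mono) auto
    also have "\<dots> \<le> r * (2 * B)" using s \<open>B > 0\<close> by (intro mult_right_mono) auto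
    finally show ?thesis by (simp add: r_def mult.commute)
  qed simp
  show ?thesis
  proof
    show "0 \<le> 2 * B" using \<open>B > 0\<close> by simp
    show "\<bar>V y - V z\<bar> \<le> 2 * B * norm (y - z)" if "y \<in> cball 0 R" "z \<in> cball 0 R" for y z
      using one[OF that] one[OF that(2,1)] by (simp add: norm_minus_commute abs_le_iff)
  qed
qed

text \<open>
  The forward bound is the chord inequality. The backward bound follows from it because \<open>y\<close> is the
  midpoint of \<open>y + h d\<close> and \<open>y - h d\<close>; thus a slope bound in the forward direction alone also limits how
  fast \<open>V\<close> can have grown before \<open>y\<close>.
\<close>

lemma convex_on_ray_bounds:
  fixes V :: "'a::real_vector \<Rightarrow> real"
  assumes V: "convex_on UNIV V" and chord: "V (y + \<tau> *\<^sub>R d) - V y \<le> \<tau> * c"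
    and h: "0 \<le> h" "h \<le> \<tau>" and "0 < \<tau>"
  shows convex_on_ray_forward: "V (y + h *\<^sub>R d) \<le> V y + h * c"
    and convex_on_ray_backward: "V y - h * c \<le> V (y - h *\<^sub>R d)"
proof -
  define s where "s = h / \<tau>"
  have s: "0 \<le> s" "s \<le> 1" "s * \<tau> = h" using h \<open>0 < \<tau>\<close> by (auto simp: s_def)
  have "V (y + h *\<^sub>R d) = V ((1 - s) *\<^sub>R y + s *\<^sub>R (y + \<tau> *\<^sub>R d))"
    using s(3) by (simp add: algebra_simps)
  also have "\<dots> \<le> (1 - s) * V y + s * V (y + \<tau> *\<^sub>R d)"
    using convex_onD[OF V s(1,2)] by simp
  also have "\<dots> = V y + s * (V (y + \<tau> *\<^sub>R d) - V y)" by (simp add: algebra_simps)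
  also have "\<dots> \<le> V y + s * (\<tau> * c)" using s chord by (intro add_left_mono mult_left_mono) auto
  finally show forward: "V (y + h *\<^sub>R d) \<le> V y + h * c" using s(3) by (simp flip: mult.assoc)
  have "V y = V ((1 - 1/2) *\<^sub>R (y + h *\<^sub>R d) + (1/2) *\<^sub>R (y - h *\<^sub>R d))"
    by (simp add: algebra_simps flip: scaleR_add_left)
  also have "\<dots> \<le> (1 - 1/2) * V (y + h *\<^sub>R d) + (1/2) * V (y - h *\<^sub>R d)"
    by (rule convex_onD[OF V]) auto
  finally show "V y - h * c \<le> V (y - h *\<^sub>R d)" using forward by simp
qed

text \<open>
  The curve is compared with its tangent line at \<open>t\<close>: on the line both ray bounds apply, and the error is
  \<open>o(s - t)\<close> because \<open>V\<close> is Lipschitz near \<open>x t\<close>.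
\<close>

lemma convex_on_straddle:
  fixes V :: "'a::euclidean_space \<Rightarrow> real" and x :: "real \<Rightarrow> 'a"
  assumes V: "convex_on UNIV V" and "0 < \<tau>" and "0 < e"
    and deriv: "(x has_vector_derivative d) (at t within S)"
    and chord: "V (x t + \<tau> *\<^sub>R d) - V (x t) \<le> \<tau> * c"
  shows "\<exists>\<delta>>0. \<forall>u\<in>S. \<forall>v\<in>S. u \<le> t \<and> t \<le> v \<and> t - u < \<delta> \<and> v - t < \<delta>
           \<longrightarrow> V (x v) - V (x u) \<le> (c + e) * (v - u)"
proof -
  define R where "R = norm (x t) + 1"
  obtain L where "0 \<le> L"
    and L: "\<And>y z. y \<in> cball 0 R \<Longrightarrow> z \<in> cball 0 R \<Longrightarrow> \<bar>V y - V z\<bar> \<le> L * norm (y - z)"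
    using convex_on_lipschitz_cball[OF V] by blast
  define e' where "e' = e / (L + 1)"
  have "0 < e'" and Le: "L * e' \<le> e" using \<open>0 < e\<close> \<open>0 \<le> L\<close> by (auto simp: e'_def field_simps)
  obtain \<delta>0 where "\<delta>0 > 0"
    and \<delta>0: "\<And>s. s \<in> S \<Longrightarrow> norm (s - t) < \<delta>0 \<Longrightarrow> norm (x s - x t - (s - t) *\<^sub>R d) \<le> e' * norm (s - t)"
    using deriv \<open>0 < e'\<close> unfolding has_vector_derivative_def has_derivative_within_alt by blast
  \<comment> \<open>The bound \<open>\<tau>\<close> keeps the tangent points on the chord, and the last bound keeps all points in the
     ball of radius \<open>R\<close>, where \<open>L\<close> is valid.\<close>
  define \<delta> where "\<delta> = min \<delta>0 (min \<tau> (1 / (norm d + e')))"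
  have den: "norm d + e' > 0" using \<open>0 < e'\<close> by (simp add: add_nonneg_pos)
  then have "\<delta> > 0" using \<open>\<delta>0 > 0\<close> \<open>0 < \<tau>\<close> by (simp add: \<delta>_def)
  have near: "\<bar>V (x s) - V (x t + (s - t) *\<^sub>R d)\<bar> \<le> e * \<bar>s - t\<bar>" if "s \<in> S" "\<bar>s - t\<bar> < \<delta>" for s
  proof -
    have err: "norm (x s - x t - (s - t) *\<^sub>R d) \<le> e' * \<bar>s - t\<bar>"
      using \<delta>0[of s] that by (simp add: \<delta>_def)
    have "\<bar>s - t\<bar> \<le> 1 / (norm d + e')" using that by (simp add: \<delta>_def)
    then have small: "\<bar>s - t\<bar> * norm d + e' * \<bar>s - t\<bar> \<le> 1" using den by (simp add: field_simps)
    have "0 \<le> e' * \<bar>s - t\<bar>" using \<open>0 < e'\<close> by simp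
    then have "norm (x t + (s - t) *\<^sub>R d) \<le> R"
      using norm_triangle_ineq[of "x t" "(s - t) *\<^sub>R d"] small by (simp add: R_def)
    moreover have "norm (x s) \<le> R"
      using norm_triangle_ineq[of "x t + (s - t) *\<^sub>R d" "x s - x t - (s - t) *\<^sub>R d"]
        norm_triangle_ineq[of "x t" "(s - t) *\<^sub>R d"] small err by (simp add: R_def)
    ultimately have "\<bar>V (x s) - V (x t + (s - t) *\<^sub>R d)\<bar> \<le> L * norm (x s - (x t + (s - t) *\<^sub>R d))"
      by (intro L) auto
    also have "\<dots> \<le> L * (e' * \<bar>s - t\<bar>)"
      using err \<open>0 \<le> L\<close> by (intro mult_left_mono) (auto simp: diff_diff_add)
    also have "\<dots> \<le> e * \<bar>s - t\<bar>"
      using mult_right_mono[OF Le, of "\<bar>s - t\<bar>"] by (simp add: mult.assoc)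
    finally show ?thesis .
  qed
  have "V (x v) - V (x u) \<le> (c + e) * (v - u)"
    if "u \<in> S" "v \<in> S" and uv: "u \<le> t" "t \<le> v" "t - u < \<delta>" "v - t < \<delta>" for u v
  proof -
    have "V (x t + (v - t) *\<^sub>R d) \<le> V (x t) + (v - t) * c"
      using uv by (intro convex_on_ray_forward[OF V chord]) (auto simp: \<delta>_def \<open>0 < \<tau>\<close>)
    moreover have "V (x t) - (t - u) * c \<le> V (x t - (t - u) *\<^sub>R d)"
      using uv by (intro convex_on_ray_backward[OF V chord]) (auto simp: \<delta>_def \<open>0 < \<tau>\<close>)
    moreover have "x t - (t - u) *\<^sub>R d = x t + (u - t) *\<^sub>R d" by (simp add: algebra_simps)
    moreover have "\<bar>V (x v) - V (x t + (v - t) *\<^sub>R d)\<bar> \<le> e * (v - t)"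
      using near[of v] that by simp
    moreover have "\<bar>V (x u) - V (x t + (u - t) *\<^sub>R d)\<bar> \<le> e * (t - u)"
      using near[of u] that by simp
    ultimately have "V (x v) - V (x u) \<le> (v - t) * c + e * (v - t) + (t - u) * c + e * (t - u)"
      by (simp add: abs_le_iff)
    then show ?thesis by (simp add: algebra_simps)
  qed
  with \<open>\<delta> > 0\<close> show ?thesis by blast
qed

proposition convex_along_abs_continuous:
  fixes V :: "'a::euclidean_space \<Rightarrow> real" and x :: "real \<Rightarrow> 'a"
  assumes V: "convex_on UNIV V" and "0 < \<tau>" and "a \<le> b"
    and ac: "abs_continuous_fun_on {a..b} x" and N: "negligible N"
    and deriv: "\<And>t. t \<in> {a..b} - N \<Longrightarrow> (x has_vector_derivative d t) (at t within {a..b})"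
    and chord: "\<And>t. t \<in> {a..b} - N \<Longrightarrow> V (x t + \<tau> *\<^sub>R d t) - V (x t) \<le> \<tau> * c"
  shows "V (x b) - V (x a) \<le> c * (b - a)"
proof -
  have "bounded (x ` {a..b})"
    using abs_continuous_imp_continuous_on[OF ac] by (intro compact_imp_bounded compact_continuous_image) auto
  then obtain R where "\<forall>y\<in>x ` {a..b}. norm y \<le> R"
    unfolding bounded_iff by blast
  then have R: "x ` {a..b} \<subseteq> cball 0 R" by auto
  obtain L where "0 \<le> L"
    and L: "\<And>y z. y \<in> cball 0 R \<Longrightarrow> z \<in> cball 0 R \<Longrightarrow> \<bar>V y - V z\<bar> \<le> L * norm (y - z)"
    using convex_on_lipschitz_cball[OF V] by blast
  have "abs_continuous_fun_on {a..b} (V \<circ> x)"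
    by (rule abs_continuous_lipschitz_compose[OF ac _ \<open>0 \<le> L\<close>]) (use R L in \<open>metis real_norm_def subsetD\<close>)
  then have "(V \<circ> x) b - (V \<circ> x) a \<le> c * (b - a)"
  proof (rule abs_continuous_growth_bound[OF _ \<open>a \<le> b\<close> N])
    fix t e :: real
    assume t: "t \<in> {a..b} - N" and "0 < e"
    show "\<exists>\<delta>>0. \<forall>u v. a \<le> u \<and> u \<le> t \<and> t \<le> v \<and> v \<le> b \<and> t - u < \<delta> \<and> v - t < \<delta>
         \<longrightarrow> (V \<circ> x) v - (V \<circ> x) u \<le> (c + e) * (v - u)"
      using convex_on_straddle[OF V \<open>0 < \<tau>\<close> \<open>0 < e\<close> deriv[OF t] chord[OF t]] t by fastforce
  qed
  then show ?thesis by simp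
qed

text \<open>
  By convexity and \<open>V 0 = 0\<close>, outside the unit ball \<open>V\<close> grows at least linearly, with slope its minimum
  on the unit sphere.
\<close>

lemma convex_positive_definite_bounded_sublevel:
  fixes V :: "'a::euclidean_space \<Rightarrow> real"
  assumes V: "convex_on UNIV V" and pd: "positive_definite_fun V"
  shows "bounded {y. V y \<le> r}"
proof -
  have "continuous_on (sphere 0 1) V"
    using convex_on_continuous[OF open_UNIV V] continuous_on_subset by blast
  then obtain y0 where y0: "y0 \<in> sphere 0 1" "\<And>y. y \<in> sphere 0 1 \<Longrightarrow> V y0 \<le> V y"
    using continuous_attains_inf[of "sphere (0::'a) 1" V] by (auto simp: sphere_eq_empty)
  define m where "m = V y0"
  have "y0 \<noteq> 0" using y0(1) by auto
  then have "m > 0" using pd by (simp add: m_def positive_definite_fun_def)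
  have "norm y \<le> max 1 (r / m)" if "V y \<le> r" for y
  proof (cases "norm y \<le> 1")
    case False
    define s where "s = 1 / norm y"
    have s: "0 \<le> s" "s \<le> 1" using False by (auto simp: s_def divide_le_eq)
    have "norm (s *\<^sub>R y) = 1" using False by (auto simp: s_def)
    then have "m \<le> V (s *\<^sub>R y)" using y0(2) by (simp add: m_def)
    also have "\<dots> \<le> s * V y"
      using convex_onD[OF V s, of 0 y] pd by (simp add: positive_definite_fun_def)
    also have "\<dots> \<le> s * r" using s that by (intro mult_left_mono) auto
    finally have "norm y * m \<le> norm y * (s * r)" by (intro mult_left_mono) auto
    also have "\<dots> = r" using False by (auto simp: s_def)
    finally have "norm y * m \<le> r" .
    then show ?thesis using \<open>m > 0\<close> by (simp add: field_simps le_max_iff_disj)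
  qed simp
  then show ?thesis unfolding bounded_iff by blast
qed

section \<open>The control set and the Euler difference\<close>

lemma compact_weights: "compact (weights :: (real ^ 'm::finite) set)"
proof -
  have "closed (weights :: (real ^ 'm) set)"
    unfolding weights_def
    by (intro closed_Collect_conj closed_Collect_all closed_Collect_eq closed_Collect_le continuous_intros)
  moreover have "weights \<subseteq> cbox 0 (1 :: real ^ 'm)"
  proof
    fix w :: "real ^ 'm" assume w: "w \<in> weights"
    have "w $ i \<le> 1" for i
      using member_le_sum[of i UNIV "\<lambda>i. w $ i"] w by (simp add: weights_def)
    with w show "w \<in> cbox 0 1" by (simp add: mem_box_cart weights_def)
  qed
  ultimately show ?thesis
    using bounded_cbox bounded_subset compact_eq_bounded_closed by blast
qed

lemma comb_vector_mult:
  "comb A w *v y = (\<Sum>i\<in>UNIV. (w $ i) *\<^sub>R (A i *v y))"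
proof -
  have "(\<Sum>i\<in>F. (w $ i) *\<^sub>R A i) *v y = (\<Sum>i\<in>F. (w $ i) *\<^sub>R (A i *v y))" if "finite F" for F
    using that by induction (auto simp: matrix_vector_mult_add_rdistrib scaleR_matrix_vector_assoc)
  then show ?thesis by (simp add: comb_def)
qed

lemma continuous_on_comb_vector_mult:
  "continuous_on S (\<lambda>(y, w). comb A w *v y)"
  unfolding comb_vector_mult case_prod_beta
  by (intro continuous_intros linear_continuous_on_compose[OF continuous_on_fst] matrix_vector_mul_linear continuous_on_id)

lemma euler_diff_nonpos:
  assumes "0 < \<tau>" "weak_convex_lyapunov \<tau> A V" "w \<in> weights"
  shows "euler_diff \<tau> A V x w \<le> 0"
proof -
  have "(mat 1 + \<tau> *\<^sub>R comb A w) *v x = x + \<tau> *\<^sub>R (comb A w *v x)"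
    by (simp add: matrix_vector_mult_add_rdistrib scaleR_matrix_vector_assoc)
  then have "V (x + \<tau> *\<^sub>R (comb A w *v x)) \<le> V x"
    using assms unfolding weak_convex_lyapunov_def by metis
  then show ?thesis using \<open>0 < \<tau>\<close> by (simp add: euler_diff_def divide_nonpos_pos)
qed

text \<open>Since \<open>\<Delta>\<^sub>\<tau> V\<close> is nonpositive, any weight at which it vanishes is automatically a minimizer.\<close>

lemma min_zero_set_iff:
  assumes "0 < \<tau>" "weak_convex_lyapunov \<tau> A V"
  shows "y \<in> min_zero_set \<tau> A V \<longleftrightarrow> (\<exists>w\<in>weights. euler_diff \<tau> A V y w = 0)"
proof
  assume "\<exists>w\<in>weights. euler_diff \<tau> A V y w = 0"
  then obtain w where w: "w \<in> weights" "euler_diff \<tau> A V y w = 0" by blast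
  then have "is_arg_min (\<lambda>w. - euler_diff \<tau> A V y w) (\<lambda>w. w \<in> weights) w"
    using euler_diff_nonpos[OF assms] by (simp add: is_arg_min_linorder)
  with w show "y \<in> min_zero_set \<tau> A V" unfolding min_zero_set_def by auto
qed (auto simp: min_zero_set_def is_arg_min_def)

text \<open>
  Off \<open>\<D>\<close> the Euler difference is strictly negative for every weight, and it is continuous jointly in the
  state and the weight; so it is bounded away from \<open>0\<close> on a compact set.
\<close>

lemma euler_diff_uniformly_negative:
  fixes A :: "'m::finite \<Rightarrow> real ^ 'n ^ 'n"
  assumes "0 < \<tau>" and lyap: "weak_convex_lyapunov \<tau> A V"
    and "compact C" and disj: "C \<inter> min_zero_set \<tau> A V = {}"
  obtains \<gamma> where "0 < \<gamma>" "\<And>y w. \<lbrakk>y \<in> C; w \<in> weights\<rbrakk> \<Longrightarrow> euler_diff \<tau> A V y w \<le> - \<gamma>"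
proof (cases "C \<times> (weights :: (real ^ 'm) set) = {}")
  case True
  show ?thesis by (rule that[of 1]) (use True in auto)
next
  case False
  have V: "continuous_on UNIV V"
    using lyap convex_on_continuous open_UNIV unfolding weak_convex_lyapunov_def by blast
  let ?g = "\<lambda>(y, w). euler_diff \<tau> A V y w"
  have "continuous_on (C \<times> weights) ?g"
    unfolding euler_diff_def case_prod_beta using \<open>0 < \<tau>\<close>
    by (intro continuous_intros continuous_on_compose2[OF V]
        continuous_on_comb_vector_mult[unfolded case_prod_beta]) auto
  moreover have "compact (C \<times> (weights :: (real ^ 'm) set))"
    using \<open>compact C\<close> compact_weights by (rule compact_Times)
  ultimately obtain q where q: "q \<in> C \<times> weights" "\<And>z. z \<in> C \<times> weights \<Longrightarrow> ?g z \<le> ?g q"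
    using continuous_attains_sup[of "C \<times> weights" ?g] False by blast
  show ?thesis
  proof (rule that[of "- ?g q"])
    have "?g q \<noteq> 0"
      using q(1) disj min_zero_set_iff[OF \<open>0 < \<tau>\<close> lyap] by fastforce
    then show "0 < - ?g q"
      using euler_diff_nonpos[OF \<open>0 < \<tau>\<close> lyap] q(1) by (force simp: less_le)
    show "euler_diff \<tau> A V y w \<le> - (- ?g q)" if "y \<in> C" "w \<in> weights" for y w
      using q(2)[of "(y, w)"] that by simp
  qed
qed

section \<open>Convergence of solutions\<close>

lemma inclusion_solutionE:
  fixes A :: "'m::finite \<Rightarrow> real ^ 'n ^ 'n"
  assumes "inclusion_solution A x"
  obtains w N where "\<And>t. 0 \<le> t \<Longrightarrow> w t \<in> weights" "negligible N"
    "\<And>a b. 0 \<le> a \<Longrightarrow> a \<le> b \<Longrightarrow> abs_continuous_fun_on {a..b} x"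
    "\<And>a b t. 0 \<le> a \<Longrightarrow> t \<in> {a..b} - N \<Longrightarrow> (x has_vector_derivative comb A (w t) *v x t) (at t within {a..b})"
proof -
  obtain w where w: "\<And>t. 0 \<le> t \<Longrightarrow> w t \<in> weights"
    and ac: "\<And>T. T \<ge> 0 \<Longrightarrow> abs_continuous_fun_on {0..T} x"
    and ae: "AE t in lebesgue_on {0..}.
             (x has_vector_derivative comb A (w t) *v x t) (at t within {0..})"
    using assms unfolding inclusion_solution_def by blast
  obtain N where N: "{t \<in> space (lebesgue_on {0..}). \<not> (x has_vector_derivative comb A (w t) *v x t) (at t within {0..})} \<subseteq> N"
      "N \<in> null_sets (lebesgue_on {0..})"
    using ae by (auto elim!: AE_E simp: null_sets_def)
  then have "N \<in> null_sets lebesgue" by (subst (asm) null_sets_restrict_space) auto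
  then have neg: "negligible N" by (simp add: negligible_iff_null_sets)
  show ?thesis
  proof (rule that[OF w neg])
    show "abs_continuous_fun_on {a..b} x" if "0 \<le> a" "a \<le> b" for a b
      using ac[of b] that by (auto intro: abs_continuous_fun_on_subset)
    show "(x has_vector_derivative comb A (w t) *v x t) (at t within {a..b})"
      if "0 \<le> a" "t \<in> {a..b} - N" for a b t
    proof (rule has_vector_derivative_within_subset)
      show "(x has_vector_derivative comb A (w t) *v x t) (at t within {0..})"
      proof (rule ccontr)
        assume "\<not> ?thesis"
        moreover have "t \<in> space (lebesgue_on {0..})" using that by (auto simp: space_restrict_space)
        ultimately show False using that N(1) by blast
      qed
    qed (use that in auto)
  qed
qed

lemma lyapunov_decay:
  assumes "0 < \<tau>" and lyap: "weak_convex_lyapunov \<tau> A V" and sol: "inclusion_solution A x"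
    and ab: "0 \<le> a" "a \<le> b"
    and rate: "\<And>t w. \<lbrakk>t \<in> {a..b}; w \<in> weights\<rbrakk> \<Longrightarrow> euler_diff \<tau> A V (x t) w \<le> c"
  shows "V (x b) - V (x a) \<le> c * (b - a)"
proof -
  obtain w N where w: "\<And>t. 0 \<le> t \<Longrightarrow> w t \<in> weights" and N: "negligible N"
    and ac: "abs_continuous_fun_on {a..b} x"
    and deriv: "\<And>t. t \<in> {a..b} - N \<Longrightarrow> (x has_vector_derivative comb A (w t) *v x t) (at t within {a..b})"
    using inclusion_solutionE[OF sol] ab by metis
  show ?thesis
  proof (rule convex_along_abs_continuous[OF _ \<open>0 < \<tau>\<close> \<open>a \<le> b\<close> ac N deriv])
    show "convex_on UNIV V" using lyap by (simp add: weak_convex_lyapunov_def)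
    show "V (x t + \<tau> *\<^sub>R (comb A (w t) *v x t)) - V (x t) \<le> \<tau> * c" if "t \<in> {a..b} - N" for t
      using rate[of t "w t"] w[of t] that ab \<open>0 < \<tau>\<close>
      by (simp add: euler_diff_def pos_divide_le_eq mult.commute)
  qed
qed

lemma lyapunov_nonincreasing:
  assumes "0 < \<tau>" "weak_convex_lyapunov \<tau> A V" "inclusion_solution A x" "0 \<le> a" "a \<le> b"
  shows "V (x b) \<le> V (x a)"
proof -
  have "V (x b) - V (x a) \<le> 0 * (b - a)"
    by (rule lyapunov_decay[OF assms]) (rule euler_diff_nonpos[OF assms(1,2)])
  then show ?thesis by simp
qed

text \<open>
  The convex function here is the distance to \<open>x a\<close>. Its difference over a step along the velocity
  is at most the norm of the velocity, which is bounded on a bounded set of states.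
\<close>

lemma bounded_solution_lipschitz:
  fixes A :: "'m::finite \<Rightarrow> real ^ 'n ^ 'n"
  assumes sol: "inclusion_solution A x" and R: "\<And>t. 0 \<le> t \<Longrightarrow> norm (x t) \<le> R"
  obtains K where "0 < K" "\<And>a b. \<lbrakk>0 \<le> a; a \<le> b\<rbrakk> \<Longrightarrow> norm (x b - x a) \<le> K * (b - a)"
proof -
  have "compact (cball (0 :: real ^ 'n) R \<times> (weights :: (real ^ 'm) set))"
    using compact_weights by (intro compact_Times) auto
  then have "bounded ((\<lambda>(y, w). comb A w *v y) ` (cball 0 R \<times> weights))"
    by (intro compact_imp_bounded compact_continuous_image continuous_on_comb_vector_mult)
  then obtain K where "0 < K" and K: "\<And>y w. \<lbrakk>norm y \<le> R; w \<in> weights\<rbrakk> \<Longrightarrow> norm (comb A w *v y) \<le> K"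
    unfolding bounded_pos by fastforce
  have "norm (x b - x a) \<le> K * (b - a)" if ab: "0 \<le> a" "a \<le> b" for a b
  proof -
    obtain w N where w: "\<And>t. 0 \<le> t \<Longrightarrow> w t \<in> weights" and N: "negligible N"
      and ac: "abs_continuous_fun_on {a..b} x"
      and deriv: "\<And>t. t \<in> {a..b} - N \<Longrightarrow> (x has_vector_derivative comb A (w t) *v x t) (at t within {a..b})"
      using inclusion_solutionE[OF sol] ab by metis
    have "norm (x b - x a) - norm (x a - x a) \<le> K * (b - a)"
    proof (rule convex_along_abs_continuous[OF _ zero_less_one \<open>a \<le> b\<close> ac N deriv])
      show "convex_on UNIV (\<lambda>y. norm (y - x a))"
        using convex_on_dist[of UNIV "x a"] by (simp add: dist_norm norm_minus_commute)
      show "norm (x t + 1 *\<^sub>R (comb A (w t) *v x t) - x a) - norm (x t - x a) \<le> 1 * K"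
        if "t \<in> {a..b} - N" for t
        using norm_triangle_ineq[of "x t - x a" "comb A (w t) *v x t"] K[of "x t" "w t"] R[of t] w[of t] that ab
        by (simp add: algebra_simps)
    qed
    then show ?thesis by simp
  qed
  with \<open>0 < K\<close> that show ?thesis by blast
qed

theorem proposition7:
  fixes A :: "'m::finite \<Rightarrow> real ^ 'n ^ 'n"
    and V :: "real ^ 'n \<Rightarrow> real"
    and \<tau> :: real
  assumes "0 < \<tau>"
    and "weak_convex_lyapunov \<tau> A V"
    and "positively_homogeneous V"
  shows "(\<forall>x. \<forall>w\<in>weights. euler_diff \<tau> A V x w \<le> 0) \<and>
         (\<forall>x. inclusion_solution A x \<longrightarrow>
            ((\<lambda>t. infdist (x t) (min_zero_set \<tau> A V)) \<longlongrightarrow> 0) at_top)"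
proof (intro conjI allI ballI impI)
  show "euler_diff \<tau> A V x w \<le> 0" if "w \<in> weights" for x and w :: "real ^ 'm"
    using euler_diff_nonpos assms(1,2) that by blast
next
  fix x assume sol: "inclusion_solution A x"
  let ?D = "min_zero_set \<tau> A V"
  have convex: "convex_on UNIV V" and pd: "positive_definite_fun V"
    using assms(2) by (auto simp: weak_convex_lyapunov_def)
  note mono = lyapunov_nonincreasing[OF assms(1,2) sol]
  have "bounded {y. V y \<le> V (x 0)}"
    by (rule convex_positive_definite_bounded_sublevel[OF convex pd])
  then obtain R where R: "\<And>t. 0 \<le> t \<Longrightarrow> norm (x t) \<le> R"
    unfolding bounded_iff using mono[of 0] by auto
  obtain K where "0 < K" and K: "\<And>a b. \<lbrakk>0 \<le> a; a \<le> b\<rbrakk> \<Longrightarrow> norm (x b - x a) \<le> K * (b - a)"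
    using bounded_solution_lipschitz[OF sol R] by blast
  show "((\<lambda>t. infdist (x t) ?D) \<longlongrightarrow> 0) at_top"
  proof (rule ccontr)
    assume "\<not> ?thesis"
    then obtain e where "0 < e" and "\<not> (\<forall>\<^sub>F t in at_top. dist (infdist (x t) ?D) 0 < e)"
      unfolding tendsto_iff by blast
    then have recur: "\<exists>t\<ge>T. e \<le> infdist (x t) ?D" for T
      unfolding eventually_at_top_linorder by (force simp: infdist_nonneg not_less)
    define C where "C = {y \<in> cball 0 R. e / 2 \<le> infdist y ?D}"
    have "compact C"
      unfolding C_def Collect_conj_eq Collect_mem_eq
      by (intro compact_Int_closed compact_cball closed_Collect_le continuous_intros)
    moreover have "C \<inter> ?D = {}" using \<open>0 < e\<close> by (auto simp: C_def)
    ultimately obtain \<gamma> where "0 < \<gamma>"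
      and \<gamma>: "\<And>y w. \<lbrakk>y \<in> C; w \<in> weights\<rbrakk> \<Longrightarrow> euler_diff \<tau> A V y w \<le> - \<gamma>"
      using euler_diff_uniformly_negative[OF assms(1,2)] by blast
    \<comment> \<open>Within time \<open>h\<close> the solution moves by at most \<open>e / 2\<close>.\<close>
    define h where "h = e / (2 * K)"
    have "0 < h" using \<open>0 < e\<close> \<open>0 < K\<close> by (simp add: h_def)
    have drop: "V (x (t + h)) \<le> V (x t) - \<gamma> * h" if t: "0 \<le> t" "e \<le> infdist (x t) ?D" for t
    proof -
      have "x s \<in> C" if s: "s \<in> {t..t + h}" for s
      proof -
        have "infdist (x t) ?D \<le> infdist (x s) ?D + dist (x t) (x s)" by (rule infdist_triangle)
        also have "dist (x t) (x s) \<le> K * (s - t)"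
          using K[of t s] s t by (simp add: dist_norm norm_minus_commute)
        also have "\<dots> \<le> K * h" using s \<open>0 < K\<close> by (intro mult_left_mono) auto
        also have "K * h = e / 2" using \<open>0 < K\<close> by (simp add: h_def)
        finally show ?thesis using t s R[of s] by (simp add: C_def)
      qed
      then have "V (x (t + h)) - V (x t) \<le> - \<gamma> * (t + h - t)"
        using \<gamma> t \<open>0 < h\<close> by (intro lyapunov_decay[OF assms(1,2) sol]) auto
      then show ?thesis by simp
    qed
    have "\<exists>t\<ge>0. V (x t) \<le> V (x 0) - real n * (\<gamma> * h)" for n
    proof (induction n)
      case (Suc n)
      then obtain t where t: "0 \<le> t" "V (x t) \<le> V (x 0) - real n * (\<gamma> * h)" by blast
      obtain s where s: "t \<le> s" "e \<le> infdist (x s) ?D" using recur by blast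
      then have "V (x (s + h)) \<le> V (x t) - \<gamma> * h" using drop[of s] mono[of t s] t by simp
      with t s \<open>0 < h\<close> show ?case by (intro exI[of _ "s + h"]) (simp add: algebra_simps)
    qed auto
    moreover obtain n where "V (x 0) < real n * (\<gamma> * h)"
      using \<open>0 < \<gamma>\<close> \<open>0 < h\<close> ex_less_of_nat_mult[of "\<gamma> * h"] by auto
    moreover have "0 \<le> V y" for y
      using pd unfolding positive_definite_fun_def by (cases "y = 0") (auto simp: less_imp_le)
    ultimately show False by (smt (verit))
  qed
qed

end
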